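(* Let $G$ be a graph with minimum degree at least $2$ and at least two cycles, and let $\lambda$ be an eigenvalue of its NB-matrix $B$ that is a root of unity. Then $\lambda$ is not defective, i.e. $AM(\lambda)=GM(\lambda)$.
   Context: Graphs are finite, simple, undirected, unweighted, connected. Let $\bar E$ be the set of oriented edges of $G$ (two for each undirected edge). The NB-matrix $B$ is indexed by $\bar E$ with $B_{k\to l,\,i\to j}=\delta_{jk}(1-\delta_{il})$. $AM(\lambda)$ is the algebraic multiplicity of $\lambda$ (its multiplicity as a root of the characteristic polynomial of $B$) and $GM(\lambda)$ is its geometric multiplicity (dimension of the right eigenspace). *)

theory Defs
  imports
    "Graph_Theory.Graph_Theory"
    "Jordan_Normal_Form.Char_Poly"
    "Jordan_Normal_Form.Matrix_Kernel"
begin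

text \<open>
  A finite simple undirected graph is a \<^locale>\<open>pair_graph\<close>: a finite, loop-free, symmetric
  digraph without parallel arcs. Its arcs \<^term>\<open>parcs G\<close> are exactly the oriented edges, two for
  each undirected edge, and the degree of a vertex is its \<^const>\<open>out_degree\<close>.

  Library matrices are indexed by natural numbers, so the matrix is formed relative to an
  enumeration \<open>es\<close> of the oriented edges (a distinct list with \<^prop>\<open>set es = parcs G\<close>).
  Row \<open>r\<close> belongs to the oriented edge \<open>k \<rightarrow> l = es ! r\<close>, column \<open>c\<close> to \<open>i \<rightarrow> j = es ! c\<close>, and
  the entry is \<open>\<delta>\<^sub>j\<^sub>k (1 - \<delta>\<^sub>i\<^sub>l)\<close>.
\<close>

definition nb_matrix :: "('a \<times> 'a) list \<Rightarrow> complex mat" where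
  "nb_matrix es = mat (length es) (length es) (\<lambda>(r, c).
     case (es ! r, es ! c) of ((k, l), (i, j)) \<Rightarrow>
       (if j = k then 1 else 0) * (1 - (if i = l then 1 else 0)))"

definition alg_mult :: "'a :: field mat \<Rightarrow> 'a \<Rightarrow> nat" where
  "alg_mult A x = Polynomial.order x (char_poly A)"

text \<open>\<^term>\<open>char_matrix A x\<close> is \<open>A - x I\<close>, so its kernel is the right eigenspace.\<close>

definition geom_mult :: "'a :: field mat \<Rightarrow> 'a \<Rightarrow> nat" where
  "geom_mult A x = kernel_dim (char_matrix A x)"

text \<open>
  The cycles of the undirected graph, as subgraphs, each represented by its set of undirected edges;
  thus rotating or reversing a closed walk does not give a new cycle. The bound on the length
  excludes traversing a single edge back and forth, which \<^const>\<open>pre_digraph.cycle\<close>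
  admits in a symmetric digraph.
\<close>

definition undirected_cycles :: "'a pair_pre_digraph \<Rightarrow> 'a set set set" where
  "undirected_cycles G =
     {(\<lambda>(u, v). {u, v}) ` set p | p. pre_digraph.cycle (with_proj G) p \<and> 3 \<le> length p}"

end

theory Submission
  imports Defs
    "Jordan_Normal_Form.Jordan_Normal_Form_Existence"
    "Jordan_Normal_Form.Jordan_Normal_Form_Uniqueness"
begin

text \<open>
  Write \<open>B\<close> for the non-backtracking matrix and, for a function \<open>x\<close> on the oriented edges, let
  \<open>S\<^sub>k(x)\<close> be the sum of \<open>x\<close> over the edges that enter the vertex \<open>k\<close>. Then
  \<open>(B x)(k \<rightarrow> l) = S\<^sub>k(x) - x(l \<rightarrow> k)\<close>, and expanding the product and summing vertex by vertex gives
  \<open>\<langle>B x, B y\<rangle> = \<langle>x, y\<rangle> + (\<Sum>k. (deg k - 2) S\<^sub>k(x) cnj (S\<^sub>k(y)))\<close>.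
  Since all degrees are at least 2, \<open>B\<close> never shrinks a vector.

  If \<open>B x = \<lambda> x\<close> with \<open>\<bar>\<lambda>\<bar> = 1\<close>, then \<open>B\<close> keeps the length of \<open>x\<close>, so every term
  \<open>(deg k - 2) \<bar>S\<^sub>k(x)\<bar>\<^sup>2\<close> vanishes. Hence every mixed term vanishes as well and
  \<open>\<langle>B x, B y\<rangle> = \<langle>x, y\<rangle>\<close> for all \<open>y\<close>. This forbids Jordan chains as for a
  unitary matrix: \<open>B y = \<lambda> y + x\<close> would give \<open>\<langle>x, y\<rangle> = \<langle>\<lambda> x, \<lambda> y + x\<rangle> = \<langle>x, y\<rangle> + \<lambda> \<langle>x, x\<rangle>\<close>,
  that is \<open>x = 0\<close>. So all Jordan blocks for \<open>\<lambda>\<close> have size 1.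
\<close>

section \<open>Eigenvalues without Jordan chains\<close>

lemma kernel_dim_cong:
  assumes "mat_kernel A = mat_kernel B" and "dim_col A = dim_col B"
  shows "kernel_dim A = kernel_dim B"
  using assms by (simp add: kernel_dim_def)

text \<open>
  In a Jordan normal form the kernel of the \<open>k\<close>-th power of \<open>A - ev I\<close> has dimension
  \<open>\<Sum> min k n\<close>, over the sizes \<open>n\<close> of the blocks for \<open>ev\<close>. If this does not grow from \<open>k = 1\<close> to
  \<open>k = 2\<close>, no block is larger than 1, and the sum of the sizes is the number of blocks.
\<close>
lemma alg_mult_eq_geom_mult_if_kernel_stable:
  fixes A :: "complex mat"
  assumes A: "A \<in> carrier_mat n n"
    and stable: "\<And>v. v \<in> carrier_vec n \<Longrightarrow> char_matrix A ev *\<^sub>v (char_matrix A ev *\<^sub>v v) = 0\<^sub>v n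
      \<Longrightarrow> char_matrix A ev *\<^sub>v v = 0\<^sub>v n"
  shows "alg_mult A ev = geom_mult A ev"
proof -
  let ?C = "char_matrix A ev"
  have C: "?C \<in> carrier_mat n n"
    using A by simp
  obtain as where "char_poly A = (\<Prod>a\<leftarrow>as. [:- a, 1:])"
    using char_poly_factorized[OF A] by auto
  from jordan_nf_exists[OF A this] obtain n_as where jnf: "jordan_nf A n_as" ..
  define sizes where "sizes = map fst (filter (\<lambda>(n, e). e = ev) n_as)"
  have C2: "?C ^\<^sub>m 2 = ?C * ?C"
    using C by (simp add: numeral_2_eq_2)
  have "mat_kernel (?C * ?C) = mat_kernel ?C"
  proof (intro equalityI subsetI)
    fix v assume "v \<in> mat_kernel (?C * ?C)"
    then have v: "v \<in> carrier_vec n" "?C * ?C *\<^sub>v v = 0\<^sub>v n"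
      using mat_kernelD[OF mult_carrier_mat[OF C C]] by auto
    then have "?C *\<^sub>v v = 0\<^sub>v n"
      using stable[OF v(1)] assoc_mult_mat_vec[OF C C v(1)] by simp
    then show "v \<in> mat_kernel ?C"
      using mat_kernelI[OF C v(1)] by simp
  next
    fix v assume "v \<in> mat_kernel ?C"
    then show "v \<in> mat_kernel (?C * ?C)"
      using mat_kernel_mult_subset[OF C C] by auto
  qed
  then have ker: "kernel_dim (?C ^\<^sub>m 2) = kernel_dim (?C ^\<^sub>m 1)"
    unfolding C2 using C by (intro kernel_dim_cong) auto
  have dims: "kernel_dim (?C ^\<^sub>m k) = (\<Sum>n\<leftarrow>sizes. min k n)" for k
    using dim_gen_eigenspace[OF jnf, of ev k] by (simp add: dim_gen_eigenspace_def sizes_def)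
  have eq: "(\<Sum>n\<leftarrow>sizes. min 2 n) = (\<Sum>n\<leftarrow>sizes. min 1 n)"
    using ker unfolding dims .
  have mono: "(\<Sum>n\<leftarrow>ns. min 1 n) \<le> (\<Sum>n\<leftarrow>ns. min 2 n)" for ns :: "nat list"
    by (rule sum_list_mono) auto
  have "(\<Sum>n\<leftarrow>ns. min 2 n) = (\<Sum>n\<leftarrow>ns. min 1 n) \<Longrightarrow>
      sum_list ns = (\<Sum>n\<leftarrow>ns. min 1 n)"
    for ns :: "nat list"
  proof (induction ns)
    case (Cons m ns)
    have "min 2 m = min 1 m" "(\<Sum>n\<leftarrow>ns. min 2 n) = (\<Sum>n\<leftarrow>ns. min 1 n)"
      using Cons.prems mono[of ns] by auto
    then show ?case
      using Cons.IH by (auto simp: min_def split: if_splits)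
  qed simp
  from this[OF eq] have "sum_list sizes = (\<Sum>n\<leftarrow>sizes. min 1 n)" .
  moreover have "alg_mult A ev = sum_list sizes"
    unfolding alg_mult_def jordan_nf_order[OF jnf] sizes_def by (simp add: case_prod_unfold)
  moreover have "geom_mult A ev = (\<Sum>n\<leftarrow>sizes. min 1 n)"
    using dims[of 1] C by (simp add: geom_mult_def)
  ultimately show ?thesis
    by simp
qed

text \<open>
  A unitary matrix is isometric on all pairs of vectors. To exclude Jordan chains it suffices to
  pair an eigenvector \<open>x\<close> with a vector \<open>y\<close> that \<open>A - ev I\<close> maps to \<open>x\<close>.
\<close>
lemma alg_mult_eq_geom_mult_if_eigenvectors_isometric:
  fixes A :: "complex mat"
  assumes A: "A \<in> carrier_mat n n" and ev: "cmod ev = 1"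
    and iso: "\<And>x y. x \<in> carrier_vec n \<Longrightarrow> y \<in> carrier_vec n \<Longrightarrow> A *\<^sub>v x = ev \<cdot>\<^sub>v x
      \<Longrightarrow> (A *\<^sub>v x) \<bullet>c (A *\<^sub>v y) = x \<bullet>c y"
  shows "alg_mult A ev = geom_mult A ev"
proof (rule alg_mult_eq_geom_mult_if_kernel_stable[OF A])
  let ?C = "char_matrix A ev"
  have C: "?C \<in> carrier_mat n n"
    using A by simp
  have split: "A *\<^sub>v w = ev \<cdot>\<^sub>v w + ?C *\<^sub>v w" if w: "w \<in> carrier_vec n" for w
  proof -
    have "?C *\<^sub>v w = A *\<^sub>v w + (- ev \<cdot>\<^sub>m 1\<^sub>m n) *\<^sub>v w"
      unfolding char_matrix_def using A w by (auto intro: add_mult_distrib_mat_vec)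
    also have "(- ev \<cdot>\<^sub>m 1\<^sub>m n) *\<^sub>v w = - ev \<cdot>\<^sub>v w"
      using w by (auto intro: eq_vecI)
    finally show ?thesis
      using A w by (auto intro!: eq_vecI)
  qed
  fix y assume y: "y \<in> carrier_vec n" and CC: "?C *\<^sub>v (?C *\<^sub>v y) = 0\<^sub>v n"
  define x where "x = ?C *\<^sub>v y"
  have x: "x \<in> carrier_vec n"
    using C y by (simp add: x_def)
  have Ax: "A *\<^sub>v x = ev \<cdot>\<^sub>v x"
    using split[OF x] CC x by (simp add: x_def)
  have "x \<bullet>c y = (ev \<cdot>\<^sub>v x) \<bullet>c (ev \<cdot>\<^sub>v y + x)"
    using iso[OF x y Ax] split[OF y] Ax by (simp add: x_def)
  also have "\<dots> = ev * cnj ev * (x \<bullet>c y) + ev * (x \<bullet>c x)"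
    using x y by (simp add: scalar_prod_def sum.distrib sum_distrib_left algebra_simps)
  also have "ev * cnj ev = 1"
    using ev by (simp add: complex_norm_square[symmetric])
  finally have "x \<bullet>c x = 0"
    using ev by auto
  then show "?C *\<^sub>v y = 0\<^sub>v n"
    using conjugate_square_eq_0_vec[OF x] by (simp add: x_def)
qed

section \<open>The non-backtracking operator\<close>

text \<open>
  The graph enters through the set \<open>E\<close> of its oriented edges. As \<open>E\<close> is symmetric, \<open>E `` {k}\<close>
  consists of the origins of the edges that enter \<open>k\<close> as well as of the ends of those that leave it.
\<close>
definition inflow :: "('a \<times> 'a) set \<Rightarrow> ('a \<times> 'a \<Rightarrow> complex) \<Rightarrow> 'a \<Rightarrow> complex" where
  "inflow E f k = (\<Sum>i\<in>E `` {k}. f (i, k))"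

definition nb_op :: "('a \<times> 'a) set \<Rightarrow> ('a \<times> 'a \<Rightarrow> complex) \<Rightarrow> 'a \<times> 'a \<Rightarrow> complex" where
  "nb_op E f = (\<lambda>(k, l). inflow E f k - f (l, k))"

lemma nb_matrix_carrier: "nb_matrix es \<in> carrier_mat (length es) (length es)"
  by (simp add: nb_matrix_def)

lemma nb_matrix_mult_vec:
  assumes es: "distinct es" "set es = E" and E: "sym E"
    and v: "v \<in> carrier_vec (length es)" and f: "\<And>i. i < length es \<Longrightarrow> f (es ! i) = v $ i"
    and r: "r < length es"
  shows "(nb_matrix es *\<^sub>v v) $ r = nb_op E f (es ! r)"
proof -
  obtain k l where kl: "es ! r = (k, l)"
    by fastforce
  have fin: "finite E"
    using es(2) by auto
  have lk: "(l, k) \<in> E"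
    using kl r es(2) E nth_mem[OF r] by (auto dest: symD)
  have "(nb_matrix es *\<^sub>v v) $ r =
      (\<Sum>c\<in>{..<length es}. if snd (es ! c) = k \<and> fst (es ! c) \<noteq> l then f (es ! c) else 0)"
    using r v kl
    by (auto simp: nb_matrix_def scalar_prod_def f atLeast0LessThan split: prod.splits
        intro!: sum.cong)
  also have "\<dots> = (\<Sum>e\<in>E. if snd e = k \<and> fst e \<noteq> l then f e else 0)"
    by (rule sum.reindex_bij_betw[OF bij_betw_nth[OF es(1) refl es(2)[symmetric]]])
  also have "\<dots> = (\<Sum>e\<in>{e \<in> E. snd e = k \<and> fst e \<noteq> l}. f e)"
    using fin by (simp add: sum.inter_filter)
  also have "{e \<in> E. snd e = k \<and> fst e \<noteq> l} = (\<lambda>i. (i, k)) ` (E `` {k} - {l})"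
    using E by (auto dest: symD)
  also have "sum f \<dots> = (\<Sum>i\<in>E `` {k} - {l}. f (i, k))"
    by (subst sum.reindex) (auto simp: inj_on_def)
  also have "\<dots> = inflow E f k - f (l, k)"
    unfolding inflow_def using lk E fin by (subst sum_diff1) (auto dest: symD)
  finally show ?thesis
    by (simp add: nb_op_def kl)
qed

lemma sum_complement_products:
  fixes a b :: "'b \<Rightarrow> complex"
  shows "(\<Sum>i\<in>N. (sum a N - a i) * cnj (sum b N - b i)) =
    (\<Sum>i\<in>N. a i * cnj (b i)) + (of_nat (card N) - 2) * (sum a N * cnj (sum b N))"
proof -
  have "(\<Sum>i\<in>N. (sum a N - a i) * cnj (sum b N - b i)) =
      (\<Sum>i\<in>N. a i * cnj (b i)) + of_nat (card N) * (sum a N * cnj (sum b N))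
      - sum a N * (\<Sum>i\<in>N. cnj (b i)) - (\<Sum>i\<in>N. a i) * cnj (sum b N)"
    by (simp add: algebra_simps sum.distrib sum_subtractf sum_distrib_left sum_distrib_right
        del: cnj_sum)
  also have "(\<Sum>i\<in>N. cnj (b i)) = cnj (sum b N)"
    by simp
  finally show ?thesis
    by (simp add: algebra_simps)
qed

text \<open>
  Grouping the edges \<open>k \<rightarrow> l\<close> by their origin \<open>k\<close>, the local identity above applies to the values of
  \<open>f\<close> and \<open>g\<close> on the edges that enter \<open>k\<close>; summed over \<open>k\<close>, these are again all the edges.
\<close>
lemma nb_op_inner:
  assumes E: "sym E" "finite E"
  shows "(\<Sum>e\<in>E. nb_op E f e * cnj (nb_op E g e)) = (\<Sum>e\<in>E. f e * cnj (g e)) +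
    (\<Sum>k\<in>fst ` E. (of_nat (card (E `` {k})) - 2) * (inflow E f k * cnj (inflow E g k)))"
proof -
  have E_Sigma: "E = Sigma (fst ` E) (\<lambda>k. E `` {k})"
    by force
  have by_origin: "(\<Sum>e\<in>E. h e) = (\<Sum>k\<in>fst ` E. \<Sum>l\<in>E `` {k}. h (k, l))"
    for h :: "'a \<times> 'a \<Rightarrow> complex"
    using E(2) by (subst E_Sigma, subst sum.Sigma) auto
  have swap: "bij_betw prod.swap E E"
    using E(1) by (intro bij_betwI[where g = prod.swap]) (auto dest: symD)
  have "(\<Sum>e\<in>E. f e * cnj (g e)) = (\<Sum>e\<in>E. f (prod.swap e) * cnj (g (prod.swap e)))"
    by (rule sum.reindex_bij_betw[OF swap, symmetric])
  also have "\<dots> = (\<Sum>k\<in>fst ` E. \<Sum>l\<in>E `` {k}. f (l, k) * cnj (g (l, k)))"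
    by (subst by_origin) simp
  finally have by_end:
    "(\<Sum>e\<in>E. f e * cnj (g e)) = (\<Sum>k\<in>fst ` E. \<Sum>l\<in>E `` {k}. f (l, k) * cnj (g (l, k)))" .
  have "(\<Sum>e\<in>E. nb_op E f e * cnj (nb_op E g e)) =
      (\<Sum>k\<in>fst ` E. \<Sum>l\<in>E `` {k}. (inflow E f k - f (l, k)) * cnj (inflow E g k - g (l, k)))"
    by (subst by_origin) (simp add: nb_op_def)
  then show ?thesis
    unfolding by_end inflow_def sum_complement_products by (simp add: sum.distrib)
qed

text \<open>
  Taking \<open>g = f\<close> in the expansion turns the error term into a sum of nonnegative reals that is
  zero, so each \<open>(deg k - 2) S\<^sub>k(f)\<close> is zero; this kills the error term for every \<open>g\<close>.
\<close>
lemma nb_op_inner_if_norm_preserved: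
  assumes E: "sym E" "finite E" and deg: "\<And>k. k \<in> fst ` E \<Longrightarrow> 2 \<le> card (E `` {k})"
    and len: "(\<Sum>e\<in>E. nb_op E f e * cnj (nb_op E f e)) = (\<Sum>e\<in>E. f e * cnj (f e))"
  shows "(\<Sum>e\<in>E. nb_op E f e * cnj (nb_op E g e)) = (\<Sum>e\<in>E. f e * cnj (g e))"
proof -
  let ?q = "\<lambda>k. (real (card (E `` {k})) - 2) * (cmod (inflow E f k))\<^sup>2"
  have q: "complex_of_real (?q k) =
      (of_nat (card (E `` {k})) - 2) * (inflow E f k * cnj (inflow E f k))" for k
    by (simp flip: complex_norm_square)
  have "complex_of_real (\<Sum>k\<in>fst ` E. ?q k) = 0"
    unfolding of_real_sum q using nb_op_inner[OF E, of f f] len by simp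
  then have "(\<Sum>k\<in>fst ` E. ?q k) = 0"
    unfolding of_real_eq_0_iff .
  moreover have "\<And>k. k \<in> fst ` E \<Longrightarrow> 0 \<le> ?q k"
    using deg by fastforce
  ultimately have zero: "\<And>k. k \<in> fst ` E \<Longrightarrow> ?q k = 0"
    using E(2) sum_nonneg_eq_0_iff[of "fst ` E" ?q] by blast
  have "(of_nat (card (E `` {k})) - 2) * (inflow E f k * cnj (inflow E g k)) = 0"
    if "k \<in> fst ` E" for k
  proof (cases "inflow E f k = 0")
    case False
    then have "card (E `` {k}) = 2"
      using zero[OF that] by simp
    then show ?thesis
      by simp
  qed simp
  then show ?thesis
    using nb_op_inner[OF E, of f g] by simp
qed

section \<open>Eigenvalues of modulus one\<close>

lemma nb_matrix_eigenvector_isometric: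
  assumes es: "distinct es" "set es = E" and E: "sym E"
    and deg: "\<And>k. k \<in> fst ` E \<Longrightarrow> 2 \<le> card (E `` {k})"
    and ev: "cmod ev = 1"
    and x: "x \<in> carrier_vec (length es)" and y: "y \<in> carrier_vec (length es)"
    and eigen: "nb_matrix es *\<^sub>v x = ev \<cdot>\<^sub>v x"
  shows "(nb_matrix es *\<^sub>v x) \<bullet>c (nb_matrix es *\<^sub>v y) = x \<bullet>c y"
proof -
  let ?n = "length es"
  have fin: "finite E"
    using es(2) by auto
  have bij: "bij_betw ((!) es) {..<?n} E"
    by (rule bij_betw_nth[OF es(1) refl es(2)[symmetric]])
  define on_edges :: "complex vec \<Rightarrow> 'a \<times> 'a \<Rightarrow> complex"
    where "on_edges v e = v $ inv_into {..<?n} ((!) es) e" for v e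
  have on_edges: "on_edges v (es ! i) = v $ i" if "i < ?n" for v i
    using bij_betw_inv_into_left[OF bij, of i] that by (simp add: on_edges_def)
  have inner: "v \<bullet>c w = (\<Sum>e\<in>E. f e * cnj (g e))"
    if "w \<in> carrier_vec ?n" "\<And>i. i < ?n \<Longrightarrow> f (es ! i) = v $ i"
      "\<And>i. i < ?n \<Longrightarrow> g (es ! i) = w $ i" for v w f g
  proof -
    have "v \<bullet>c w = (\<Sum>i<?n. f (es ! i) * cnj (g (es ! i)))"
      using that by (simp add: scalar_prod_def atLeast0LessThan)
    also have "\<dots> = (\<Sum>e\<in>E. f e * cnj (g e))"
      by (rule sum.reindex_bij_betw[OF bij])
    finally show ?thesis .
  qed
  have nb_op: "nb_op E (on_edges v) (es ! i) = (nb_matrix es *\<^sub>v v) $ i"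
    if "v \<in> carrier_vec ?n" "i < ?n" for v i
    using nb_matrix_mult_vec[OF es E that(1) on_edges that(2)] by simp
  have nb_inner: "(nb_matrix es *\<^sub>v v) \<bullet>c (nb_matrix es *\<^sub>v w) =
      (\<Sum>e\<in>E. nb_op E (on_edges v) e * cnj (nb_op E (on_edges w) e))"
    if "v \<in> carrier_vec ?n" "w \<in> carrier_vec ?n" for v w
    using that nb_op nb_matrix_carrier[of es] by (intro inner) auto
  have "(nb_matrix es *\<^sub>v x) \<bullet>c (nb_matrix es *\<^sub>v x) = ev * cnj ev * (x \<bullet>c x)"
    unfolding eigen using x
    by (simp add: scalar_prod_def sum_distrib_left algebra_simps)
  also have "ev * cnj ev = 1"
    using ev by (simp add: complex_norm_square[symmetric])
  finally have "(\<Sum>e\<in>E. nb_op E (on_edges x) e * cnj (nb_op E (on_edges x) e)) =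
      (\<Sum>e\<in>E. on_edges x e * cnj (on_edges x e))"
    using nb_inner[OF x x] inner[OF x on_edges on_edges] by simp
  from nb_op_inner_if_norm_preserved[OF E fin deg this] show ?thesis
    using nb_inner[OF x y] inner[OF y on_edges on_edges] by simp
qed

theorem theorem4p6:
  fixes G :: "'a pair_pre_digraph"
    and es :: "('a \<times> 'a) list"
    and ev :: complex
  assumes "pair_graph G"
    and "Digraph_Component.connected (with_proj G)"
    and "\<forall>v \<in> pverts G. 2 \<le> out_degree (with_proj G) v"
    and "\<exists>C \<in> undirected_cycles G. \<exists>D \<in> undirected_cycles G. C \<noteq> D"
    and "distinct es" and "set es = parcs G"
    and "eigenvalue (nb_matrix es) ev"
    and "\<exists>n::nat. 0 < n \<and> ev ^ n = 1"
  shows "alg_mult (nb_matrix es) ev = geom_mult (nb_matrix es) ev"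
proof -
  interpret pair_graph G
    by fact
  have sym: "sym (parcs G)"
    using pair_sym_arcs by (simp add: symmetric_def)
  have ev: "cmod ev = 1"
    using assms(8) power_eq_1_iff by blast
  have "2 \<le> card (parcs G `` {k})" if "k \<in> fst ` parcs G" for k
  proof -
    have "k \<in> pverts G"
      using that by (auto dest: in_arcsD1)
    then have "2 \<le> card (out_arcs (with_proj G) k)"
      using assms(3) by (simp add: out_degree_def)
    also have "out_arcs (with_proj G) k = Pair k ` (parcs G `` {k})"
      by (auto simp: out_arcs_def)
    also have "card \<dots> = card (parcs G `` {k})"
      by (rule card_image) (simp add: inj_on_def)
    finally show ?thesis .
  qed
  then show ?thesis
    using nb_matrix_eigenvector_isometric[OF assms(5,6) sym _ ev]
    by (intro alg_mult_eq_geom_mult_if_eigenvectors_isometric[OF nb_matrix_carrier ev]) blast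
qed

end
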